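(* Let $n\ge2$. For every $m\in\mathbb{N}$, $\mathbb{Z}^m$ quasi-isometrically embeds into the Whitehead complex of $F_n$, i.e. into the quotient graph $\mathrm{Cay}(F_n,\mathrm{sep}_n)/\mathrm{Inn}(F_n)$.
   Context: An element of $F_n$ is separable if it lies in a proper free factor (a subgroup generated by a proper subset of a basis); $\mathrm{sep}_n$ is the set of separable elements. $\mathrm{Cay}(F_n,\mathrm{sep}_n)$ has vertex set $F_n$ and an undirected edge between $g$ and $sg$ for $s\in\mathrm{sep}_n$. $F_n$ acts on it by conjugation, and the quotient graph $\mathrm{Cay}(F_n,\mathrm{sep}_n)/\mathrm{Inn}(F_n)$ has vertices the conjugacy classes of $F_n$, two classes being adjacent iff they have adjacent representatives; it carries the path metric. $\mathbb Z^m$ has the $\ell^1$ metric. *)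

theory Defs
  imports Complex_Main "HOL-Algebra.Generated_Groups"
begin

text \<open>The free group F_n, realised as freely reduced words over the letters
  (i, e) with i < n; e = False means the generator x_i, e = True its inverse.\<close>

type_synonym letter = "nat \<times> bool"
type_synonym word = "letter list"

definition letter_inv :: "letter \<Rightarrow> letter" where
  "letter_inv a = (fst a, \<not> snd a)"

fun reduced :: "word \<Rightarrow> bool" where
  "reduced [] = True"
| "reduced [a] = True"
| "reduced (a # b # w) = (b \<noteq> letter_inv a \<and> reduced (b # w))"

fun push :: "letter \<Rightarrow> word \<Rightarrow> word" where
  "push a [] = [a]"
| "push a (b # w) = (if b = letter_inv a then w else a # b # w)"

definition word_mult :: "word \<Rightarrow> word \<Rightarrow> word" where
  "word_mult v w = foldr push v w"

definition word_inv :: "word \<Rightarrow> word" where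
  "word_inv w = rev (map letter_inv w)"

definition FG :: "nat \<Rightarrow> word monoid" where
  "FG n = \<lparr> carrier = {w. reduced w \<and> (\<forall>a \<in> set w. fst a < n)},
            mult = word_mult, one = [] \<rparr>"

definition subst_hom :: "(nat \<Rightarrow> word) \<Rightarrow> word \<Rightarrow> word" where
  "subst_hom b w = foldr (\<lambda>a acc. word_mult (if snd a then word_inv (b (fst a)) else b (fst a)) acc) w []"

definition is_basis :: "nat \<Rightarrow> (nat \<Rightarrow> word) \<Rightarrow> bool" where
  "is_basis n b \<longleftrightarrow> (\<forall>i<n. b i \<in> carrier (FG n))
      \<and> bij_betw (subst_hom b) (carrier (FG n)) (carrier (FG n))"

text \<open>Separable elements: those lying in a proper free factor, i.e. in the
  subgroup generated by a proper subset of a basis.\<close>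
definition sep :: "nat \<Rightarrow> word set" where
  "sep n = {g \<in> carrier (FG n). \<exists>b S. is_basis n b \<and> S \<subset> {..<n}
              \<and> g \<in> generate (FG n) (b ` S)}"

definition conj_class :: "nat \<Rightarrow> word \<Rightarrow> word set" where
  "conj_class n g = {h \<in> carrier (FG n). \<exists>k \<in> carrier (FG n).
                       h = word_mult (word_mult k g) (word_inv k)}"

definition wh_vertices :: "nat \<Rightarrow> word set set" where
  "wh_vertices n = conj_class n ` carrier (FG n)"

text \<open>Two classes are adjacent iff they have representatives g, h joined by an
  edge of Cay(F_n, sep_n), i.e. h = s g or g = s h for some separable s.\<close>
definition wh_edges :: "nat \<Rightarrow> (word set \<times> word set) set" where
  "wh_edges n = {(C, D). C \<in> wh_vertices n \<and> D \<in> wh_vertices n \<and>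
      (\<exists>g \<in> C. \<exists>h \<in> D. \<exists>s \<in> sep n. h = word_mult s g \<or> g = word_mult s h)}"

definition wh_dist :: "nat \<Rightarrow> word set \<Rightarrow> word set \<Rightarrow> nat" where
  "wh_dist n C D = (LEAST k. (C, D) \<in> wh_edges n ^^ k)"

definition l1_dist :: "int list \<Rightarrow> int list \<Rightarrow> real" where
  "l1_dist x y = (\<Sum>i<length x. real_of_int \<bar>x ! i - y ! i\<bar>)"

end

theory Submission
  imports Defs "HOL-Library.Sublist"
begin

text \<open>
  Idea. For a reduced word \<open>w\<close> containing every reduced two-letter word, the Brooks counting
  quasimorphism of \<open>w\<close> is bounded on separable elements, hence is Lipschitz up to an additive constant
  on the Whitehead complex. Boundedness is a form of Whitehead's cut vertex lemma: a separable element
  stabilises, by right multiplication, a subset of the free group with finite coboundary that is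
  neither finite nor cofinite; but if the cyclically reduced conjugate contained \<open>w\<close>, the axes
  through any vertex of the Cayley tree would connect all directions at that vertex, and
  an induction from infinity towards the root would force the subset to be finite or cofinite.
  Taking words \<open>w\<^sub>0, \<dots>, w\<^sub>m\<^sub>-\<^sub>1\<close> that contain one long run of a letter, of pairwise different
  lengths, no \<open>w\<^sub>i\<close> occurs in a power of another or of an inverse, so the map sending \<open>x\<close> to the class
  of \<open>w\<^sub>0\<^bsup>x\<^sub>0\<^esup> \<cdots> w\<^sub>m\<^sub>-\<^sub>1\<^bsup>x\<^sub>m\<^sub>-\<^sub>1\<^esup>\<close> is a quasi-isometric embedding.
\<close>

section \<open>The free group of reduced words\<close>

notation word_mult (infixr "\<cdot>" 70)

lemma letter_inv_inv [simp]: "letter_inv (letter_inv a) = a"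
  by (simp add: letter_inv_def)

lemma letter_inv_neq [simp]: "letter_inv a \<noteq> a" "a \<noteq> letter_inv a"
  by (auto simp: letter_inv_def prod_eq_iff)

lemma letter_inv_eq_iff [simp]: "letter_inv a = letter_inv b \<longleftrightarrow> a = b"
  by (metis letter_inv_inv)

lemma fst_letter_inv [simp]: "fst (letter_inv a) = fst a"
  by (simp add: letter_inv_def)

lemma reduced_iff_successively:
  "reduced w \<longleftrightarrow> successively (\<lambda>a b. b \<noteq> letter_inv a) w"
  by (induction w rule: reduced.induct) auto

lemma reduced_append_iff:
  "reduced (u @ v) \<longleftrightarrow>
     reduced u \<and> reduced v \<and> (u = [] \<or> v = [] \<or> hd v \<noteq> letter_inv (last u))"
  by (auto simp: reduced_iff_successively successively_append_iff)

lemma reduced_Cons_iff: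
  "reduced (a # w) \<longleftrightarrow> reduced w \<and> (w = [] \<or> hd w \<noteq> letter_inv a)"
  by (cases w) auto

lemma word_inv_simps [simp]:
  "word_inv [] = []"
  "word_inv (a # w) = word_inv w @ [letter_inv a]"
  "word_inv (u @ v) = word_inv v @ word_inv u"
  "word_inv (word_inv w) = w"
  "length (word_inv w) = length w"
  "word_inv w = [] \<longleftrightarrow> w = []"
  by (simp_all add: word_inv_def rev_map comp_def)

lemma hd_word_inv: "w \<noteq> [] \<Longrightarrow> hd (word_inv w) = letter_inv (last w)"
  by (simp add: word_inv_def hd_rev last_map)

lemma last_word_inv: "w \<noteq> [] \<Longrightarrow> last (word_inv w) = letter_inv (hd w)"
  by (simp add: word_inv_def last_rev hd_map)

lemma reduced_word_inv [simp]: "reduced (word_inv w) \<longleftrightarrow> reduced w"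
proof -
  have "reduced (word_inv w)" if "reduced w" for w
    using that
    by (induction w) (auto simp: reduced_append_iff reduced_Cons_iff last_word_inv)
  from this[of w] this[of "word_inv w"] show ?thesis by auto
qed

lemma set_word_inv: "set (word_inv w) = letter_inv ` set w"
  by (simp add: word_inv_def)

section \<open>Multiplication by pushing letters and the resulting group\<close>

lemma reduced_push [simp]: "reduced w \<Longrightarrow> reduced (push a w)"
  by (cases w) (auto simp: reduced_Cons_iff)

text \<open>If \<open>w\<close> starts with \<open>a\<close>, the inner push strips that letter, and
  reducedness keeps the tail from starting with \<open>letter_inv a\<close>, so the outer push
  restores it.\<close>

lemma push_push_inv: "reduced w \<Longrightarrow> push a (push (letter_inv a) w) = w"
  by (cases w rule: reduced.cases) auto

lemma word_mult_Nil [simp]: "[] \<cdot> w = w"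
  by (simp add: word_mult_def)

lemma word_mult_Cons: "(a # v) \<cdot> w = push a (v \<cdot> w)"
  by (simp add: word_mult_def)

lemma word_mult_append_left: "(u @ v) \<cdot> w = u \<cdot> v \<cdot> w"
  by (simp add: word_mult_def)

lemma word_mult_eq_append: "reduced (v @ w) \<Longrightarrow> v \<cdot> w = v @ w"
proof (induction v)
  case (Cons a v)
  then show ?case by (cases "v @ w") (auto simp: word_mult_Cons)
qed simp

lemma word_mult_Nil_right [simp]: "reduced v \<Longrightarrow> v \<cdot> [] = v"
  using word_mult_eq_append[of v "[]"] by simp

lemma reduced_word_mult [simp]: "reduced w \<Longrightarrow> reduced (v \<cdot> w)"
  by (induction v) (simp_all add: word_mult_Cons)

text \<open>The case with content is \<open>v\<close> starting with \<open>letter_inv a\<close>: the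
  letter cancels on the left, and on the right the two pushes undo each other.\<close>

lemma push_word_mult: "reduced w \<Longrightarrow> push a v \<cdot> w = push a (v \<cdot> w)"
proof (cases v)
  case (Cons b v')
  assume "reduced w"
  then show ?thesis
    using Cons push_push_inv[of "v' \<cdot> w" a] by (auto simp: word_mult_Cons)
qed (simp add: word_mult_Cons)

lemma word_mult_assoc: "reduced w \<Longrightarrow> (u \<cdot> v) \<cdot> w = u \<cdot> v \<cdot> w"
  by (induction u) (simp_all add: word_mult_Cons push_word_mult)

lemma word_mult_inv_cancel: "reduced w \<Longrightarrow> v \<cdot> word_inv v \<cdot> w = w"
proof (induction v arbitrary: w)
  case (Cons a v)
  then have "(a # v) \<cdot> word_inv (a # v) \<cdot> w
      = push a (v \<cdot> word_inv v \<cdot> push (letter_inv a) w)"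
    by (simp add: word_mult_Cons word_mult_append_left)
  also have "\<dots> = w"
    using Cons by (simp add: push_push_inv)
  finally show ?case .
qed simp

lemma word_mult_inv_cancel': "reduced w \<Longrightarrow> word_inv v \<cdot> v \<cdot> w = w"
  using word_mult_inv_cancel[of w "word_inv v"] by simp

lemma word_mult_inv: "v \<cdot> word_inv v = []" if "reduced v"
  using word_mult_inv_cancel[of "[]" v] that by simp

lemma word_mult_inv': "word_inv v \<cdot> v = []" if "reduced v"
  using word_mult_inv_cancel'[of "[]" v] that by simp

lemma word_inv_word_mult:
  assumes "reduced u" "reduced v"
  shows "word_inv (u \<cdot> v) = word_inv v \<cdot> word_inv u"
proof -
  have "word_inv (u \<cdot> v) = word_inv (u \<cdot> v) \<cdot> (u \<cdot> v) \<cdot> word_inv v \<cdot> word_inv u"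
    using assms by (simp add: word_mult_assoc word_mult_inv_cancel word_mult_inv)
  also have "\<dots> = word_inv v \<cdot> word_inv u"
    using assms by (simp add: word_mult_inv_cancel')
  finally show ?thesis .
qed

lemma FG_iff: "w \<in> carrier (FG n) \<longleftrightarrow> reduced w \<and> (\<forall>a\<in>set w. fst a < n)"
  by (simp add: FG_def)

lemma FG_reduced [dest]: "w \<in> carrier (FG n) \<Longrightarrow> reduced w"
  by (simp add: FG_iff)

lemma mult_FG [simp]: "(\<otimes>\<^bsub>FG n\<^esub>) = (\<cdot>)" and one_FG [simp]: "\<one>\<^bsub>FG n\<^esub> = []"
  by (simp_all add: FG_def)

lemma set_word_mult: "set (v \<cdot> w) \<subseteq> set v \<union> set w"
proof (induction v)
  case (Cons a v)
  have "set (push a u) \<subseteq> insert a (set u)" for u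
    by (cases u) auto
  then show ?case using Cons by (fastforce simp: word_mult_Cons)
qed simp

lemma Nil_in_FG [simp]: "[] \<in> carrier (FG n)"
  by (simp add: FG_iff)

lemma word_mult_in_FG [simp]:
  "v \<in> carrier (FG n) \<Longrightarrow> w \<in> carrier (FG n) \<Longrightarrow> v \<cdot> w \<in> carrier (FG n)"
  using set_word_mult[of v w] by (auto simp: FG_iff)

lemma word_inv_in_FG_iff [simp]: "word_inv v \<in> carrier (FG n) \<longleftrightarrow> v \<in> carrier (FG n)"
  by (auto simp: FG_iff set_word_inv)

lemma group_FG: "group (FG n)"
proof (rule groupI)
  fix x assume "x \<in> carrier (FG n)"
  then show "\<exists>y\<in>carrier (FG n). y \<otimes>\<^bsub>FG n\<^esub> x = \<one>\<^bsub>FG n\<^esub>"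
    by (intro bexI[of _ "word_inv x"]) (auto simp: word_mult_inv')
qed (simp_all add: FG_reduced word_mult_assoc)

lemma inv_FG: "w \<in> carrier (FG n) \<Longrightarrow> inv\<^bsub>FG n\<^esub> w = word_inv w"
  by (rule group.inv_equality[OF group_FG]) (auto simp: word_mult_inv')

lemma finite_bounded_FG: "finite {w \<in> carrier (FG n). length w \<le> k}"
proof (rule finite_subset)
  show "{w \<in> carrier (FG n). length w \<le> k} \<subseteq> {w. set w \<subseteq> {..<n} \<times> UNIV \<and> length w \<le> k}"
    by (auto simp: FG_iff)
qed (intro finite_lists_length_le finite_cartesian_product; simp)

section \<open>Counting quasimorphisms\<close>

text \<open>An occurrence is recorded by what precedes and what follows it, so overlapping
  occurrences all count.\<close>

definition occ :: "word \<Rightarrow> word \<Rightarrow> nat" where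
  "occ w v = card {(p, s). v = p @ w @ s}"

lemma finite_occ: "finite {(p, s). v = p @ w @ s}"
proof (rule finite_subset)
  show "{(p, s). v = p @ w @ s} \<subseteq> set (prefixes v) \<times> set (suffixes v)"
    by (auto simp: suffix_def)
qed simp

lemma occ_Nil: "w \<noteq> [] \<Longrightarrow> occ w [] = 0"
  by (simp add: occ_def)

lemma occ_Cons:
  assumes "w \<noteq> []"
  shows "occ w (a # v) = occ w v + (if prefix w (a # v) then 1 else 0)"
proof -
  define A where "A = (\<lambda>(p, s). (a # p, s)) ` {(p, s). v = p @ w @ s}"
  define B where "B = (if prefix w (a # v) then {([] :: word, drop (length w) (a # v))} else {})"
  have "{(p, s). a # v = p @ w @ s} = A \<union> B"
    by (auto simp: A_def B_def Cons_eq_append_conv image_iff prefix_def)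
  then have "occ w (a # v) = card (A \<union> B)"
    by (simp add: occ_def)
  also have "\<dots> = card A + card B"
  proof (rule card_Un_disjoint)
    show "finite A" unfolding A_def by (intro finite_imageI finite_occ)
  qed (auto simp: A_def B_def)
  also have "card A = occ w v"
    unfolding occ_def A_def by (rule card_image) (auto simp: inj_on_def)
  also have "card B = (if prefix w (a # v) then 1 else 0)"
    by (simp add: B_def)
  finally show ?thesis .
qed

lemma occ_append_ge:
  assumes "w \<noteq> []"
  shows "occ w u + occ w v \<le> occ w (u @ v)"
proof (induction u)
  case (Cons a u)
  have "prefix w (a # u) \<Longrightarrow> prefix w (a # u @ v)"
    using prefix_prefix[of w "a # u" v] by simp
  then show ?case using Cons assms by (auto simp: occ_Cons)
qed (simp add: occ_Nil assms)

text \<open>Besides the occurrences inside \<open>u\<close> or \<open>v\<close> there are those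
  straddling the junction, which start in \<open>u\<close> fewer than \<open>length w\<close>
  letters before its end. Counting these starting points with the minimum lets the induction on
  \<open>u\<close> close.\<close>

lemma occ_append_le:
  assumes "w \<noteq> []"
  shows "occ w (u @ v) \<le> occ w u + occ w v + min (length u) (length w)"
proof (induction u)
  case (Cons a u)
  have "length (a # u) < length w"
    if "prefix w ((a # u) @ v)" "\<not> prefix w (a # u)"
    using that prefix_append[of w "a # u" v] by (auto simp: prefix_length_less)
  then show ?case
    using Cons assms by (auto simp: occ_Cons)
qed (simp add: occ_Nil assms)

lemma occ_word_inv: "occ (word_inv w) (word_inv v) = occ w v"
  unfolding occ_def
  by (rule bij_betw_same_card[OF bij_betw_byWitness
        [where f = "\<lambda>(p, s). (word_inv s, word_inv p)"
           and f' = "\<lambda>(p, s). (word_inv s, word_inv p)"]])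
     (auto, (metis append.assoc word_inv_simps(3,4))+)

lemma occ_eq_0: "\<not> sublist w v \<Longrightarrow> occ w v = 0"
  by (auto simp: occ_def sublist_def)

lemma occ_self: "occ w w \<ge> 1"
proof -
  have "([], []) \<in> {(p, s). w = p @ w @ s}" by simp
  then show ?thesis
    unfolding occ_def using finite_occ[of w w] by (metis card_0_eq empty_iff less_one not_less)
qed

definition brooks :: "word \<Rightarrow> word \<Rightarrow> int" where
  "brooks w v = int (occ w v) - int (occ (word_inv w) v)"

lemma brooks_Nil [simp]: "w \<noteq> [] \<Longrightarrow> brooks w [] = 0"
  by (simp add: brooks_def occ_Nil)

lemma brooks_word_inv: "brooks w (word_inv v) = - brooks w v"
  using occ_word_inv[of w v] occ_word_inv[of "word_inv w" v] by (simp add: brooks_def)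

text \<open>Each of the two counts gains between 0 and \<open>length w\<close> at the junction, so
  their difference changes by at most \<open>length w\<close>.\<close>

lemma brooks_append:
  assumes "w \<noteq> []"
  shows "\<bar>brooks w (u @ v) - brooks w u - brooks w v\<bar> \<le> length w"
proof -
  have "word_inv w \<noteq> []" using assms by simp
  then show ?thesis
    using occ_append_ge[of w u v] occ_append_le[of w u v]
      occ_append_ge[of "word_inv w" u v] occ_append_le[of "word_inv w" u v] assms
    unfolding brooks_def word_inv_simps(5) by linarith
qed

text \<open>\<open>q\<close> is the part that cancels. A letter put in front of \<open>u\<close> can
  cancel only when all of \<open>u\<close> has cancelled: it then either meets its inverse at the
  head of \<open>s\<close> and joins \<open>q\<close>, or becomes \<open>p\<close>.\<close>

lemma word_mult_cancellation:
  assumes "reduced u" "reduced v"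
  shows "\<exists>p q s. u = p @ q \<and> v = word_inv q @ s \<and> u \<cdot> v = p @ s"
  using assms
proof (induction u)
  case (Cons a u)
  then obtain p q s where *: "u = p @ q" "v = word_inv q @ s" "u \<cdot> v = p @ s"
    by (auto simp: reduced_Cons_iff)
  show ?case
  proof (cases p)
    case Nil
    show ?thesis
    proof (cases "s \<noteq> [] \<and> hd s = letter_inv a")
      case True
      then obtain s' where "s = letter_inv a # s'" by (cases s) auto
      then show ?thesis using Nil *
        by (intro exI[of _ "[]"] exI[of _ "a # u"] exI[of _ s']) (simp add: word_mult_Cons)
    next
      case False
      then show ?thesis using Nil *
        by (intro exI[of _ "[a]"] exI[of _ u] exI[of _ s]) (cases s; simp add: word_mult_Cons)
    qed
  next
    case (Cons b p')
    then have "b \<noteq> letter_inv a" using Cons.prems * by simp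
    then show ?thesis using Cons *
      by (intro exI[of _ "a # p"] exI[of _ q] exI[of _ s]) (simp add: word_mult_Cons)
  qed
qed simp

text \<open>Three junctions, inside \<open>u\<close>, inside \<open>v\<close> and in the product,
  cost at most \<open>length w\<close> each; the values at the cancelling part and at its inverse
  are opposite.\<close>

lemma brooks_word_mult:
  assumes "w \<noteq> []" "reduced u" "reduced v"
  shows "\<bar>brooks w (u \<cdot> v) - brooks w u - brooks w v\<bar> \<le> 3 * length w"
proof -
  obtain p q s where "u = p @ q" "v = word_inv q @ s" "u \<cdot> v = p @ s"
    using word_mult_cancellation assms by blast
  then show ?thesis
    using brooks_append[of w p q] brooks_append[of w "word_inv q" s] brooks_append[of w p s]
      brooks_word_inv[of w q] assms by simp
qed

section \<open>A cut vertex criterion for separability\<close>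

text \<open>\<open>E\<close> has finite coboundary in the Cayley tree, is a union of left cosets of the group generated
  by \<open>g\<close>, and has points at infinity on both sides.\<close>

definition cut :: "nat \<Rightarrow> word \<Rightarrow> word set \<Rightarrow> bool" where
  "cut n g E \<longleftrightarrow>
     (\<forall>v\<in>carrier (FG n). finite {x \<in> carrier (FG n). (x \<in> E) \<noteq> (x \<cdot> v \<in> E)}) \<and>
     (\<forall>x\<in>carrier (FG n). x \<cdot> g \<in> E \<longleftrightarrow> x \<in> E) \<and>
     infinite (carrier (FG n) \<inter> E) \<and> infinite (carrier (FG n) - E)"

lemma subst_hom_simps [simp]:
  "subst_hom b [] = []"
  "subst_hom b (a # w) =
     (if snd a then word_inv (b (fst a)) else b (fst a)) \<cdot> subst_hom b w"
  by (simp_all add: subst_hom_def)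

section \<open>The homomorphism that extends an assignment of images to the generators\<close>

context
  fixes n :: nat and b :: "nat \<Rightarrow> word"
  assumes b_FG: "\<And>i. i < n \<Longrightarrow> b i \<in> carrier (FG n)"
begin

lemma subst_hom_in_FG: "w \<in> carrier (FG n) \<Longrightarrow> subst_hom b w \<in> carrier (FG n)"
proof (induction w)
  case (Cons a w)
  then have "w \<in> carrier (FG n)" "fst a < n"
    by (auto simp: FG_iff reduced_Cons_iff)
  then show ?case using Cons.IH b_FG by simp
qed simp

lemma subst_hom_push:
  assumes "w \<in> carrier (FG n)" "fst a < n"
  shows "subst_hom b (push a w) = subst_hom b [a] \<cdot> subst_hom b w"
proof (cases "w \<noteq> [] \<and> hd w = letter_inv a")
  case True
  then obtain w' where w: "w = letter_inv a # w'" by (cases w) auto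
  then have "w' \<in> carrier (FG n)"
    using assms by (auto simp: FG_iff reduced_Cons_iff)
  then have "reduced (subst_hom b w')" "reduced (b (fst a))"
    using subst_hom_in_FG b_FG assms by auto
  then show ?thesis
    by (simp add: w letter_inv_def word_mult_inv_cancel word_mult_inv_cancel')
next
  case False
  moreover have "reduced (b (fst a))" using b_FG assms by auto
  ultimately show ?thesis by (cases w) auto
qed

lemma subst_hom_mult:
  assumes "v \<in> carrier (FG n)" "w \<in> carrier (FG n)"
  shows "subst_hom b (v \<cdot> w) = subst_hom b v \<cdot> subst_hom b w"
  using assms(1)
proof (induction v)
  case (Cons a v)
  then have *: "v \<in> carrier (FG n)" "fst a < n"
    by (auto simp: FG_iff reduced_Cons_iff)
  moreover have "reduced (b (fst a))" using b_FG * by auto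
  moreover have "reduced (subst_hom b w)" using subst_hom_in_FG assms by auto
  ultimately show ?case
    using Cons.IH assms(2) subst_hom_push[of "v \<cdot> w" a] by (simp add: word_mult_Cons word_mult_assoc)
qed simp

end

lemma replicate_in_FG: "fst a < n \<Longrightarrow> replicate k a \<in> carrier (FG n)"
proof (induction k)
  case (Suc k)
  then show ?case by (cases k) (auto simp: FG_iff)
qed simp

lemma infinite_replicate: "infinite (range (\<lambda>k. replicate (Suc k) a))"
  by (auto dest: finite_imageD simp: inj_on_def)

lemma finite_letters: "finite {a :: letter. fst a < n}"
proof -
  have "{a :: letter. fst a < n} = {..<n} \<times> UNIV" by auto
  then show ?thesis by simp
qed

lemma letter_in_FG [simp]: "[a] \<in> carrier (FG n) \<longleftrightarrow> fst a < n"
  by (simp add: FG_iff)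

lemma sep_imp_cut:
  assumes "g \<in> sep n"
  shows "\<exists>E. cut n g E"
proof -
  from assms obtain b S where b: "is_basis n b" and S: "S \<subset> {..<n}"
    and g: "g \<in> generate (FG n) (b ` S)"
    by (auto simp: sep_def)
  then obtain j where j: "j < n" "j \<notin> S" by auto
  have b_FG: "\<And>i. i < n \<Longrightarrow> b i \<in> carrier (FG n)"
    and bij: "bij_betw (subst_hom b) (carrier (FG n)) (carrier (FG n))"
    using b by (auto simp: is_basis_def)
  \<comment> \<open>In the Cayley tree of the basis \<open>b\<close>, \<open>E\<close> is one side of the edge from \<open>1\<close> to \<open>b j\<close>; translates
    of the axis of \<open>g\<close> never cross an edge labelled \<open>j\<close>.\<close>
  define E0 where "E0 = {w \<in> carrier (FG n). w \<noteq> [] \<and> hd w = (j, False)}"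
  define E where "E = subst_hom b ` E0"
  have E_iff: "subst_hom b w \<in> E \<longleftrightarrow> w \<in> E0" if "w \<in> carrier (FG n)" for w
    using bij that unfolding E_def E0_def bij_betw_def by (auto dest: inj_onD)
  have ex: "\<exists>w\<in>carrier (FG n). x = subst_hom b w" if "x \<in> carrier (FG n)" for x
    using bij that unfolding bij_betw_def by auto
  have fin: "finite {x \<in> carrier (FG n). (x \<in> E) \<noteq> (x \<cdot> v \<in> E)}"
    if v: "v \<in> carrier (FG n)" for v
  proof -
    obtain v' where v': "v' \<in> carrier (FG n)" "v = subst_hom b v'" using ex v by blast
    have "{x \<in> carrier (FG n). (x \<in> E) \<noteq> (x \<cdot> v \<in> E)}
        \<subseteq> subst_hom b ` {w \<in> carrier (FG n). length w \<le> length v'}"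
    proof
      fix x assume "x \<in> {x \<in> carrier (FG n). (x \<in> E) \<noteq> (x \<cdot> v \<in> E)}"
      then have x: "x \<in> carrier (FG n)" "(x \<in> E) \<noteq> (x \<cdot> v \<in> E)" by auto
      obtain w where w: "w \<in> carrier (FG n)" "x = subst_hom b w" using ex x by blast
      obtain p q s where pqs: "w = p @ q" "v' = word_inv q @ s" "w \<cdot> v' = p @ s"
        using word_mult_cancellation w v' by blast
      have "(w \<in> E0) \<noteq> (w \<cdot> v' \<in> E0)"
        using x w v' E_iff by (simp flip: subst_hom_mult[OF b_FG])
      moreover have "w \<cdot> v' \<in> carrier (FG n)" using w v' by simp
      \<comment> \<open>If \<open>p\<close> is nonempty, \<open>w\<close> and the product share
        their first letter and lie on the same side; a change of side needs all of \<open>w\<close>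
        to cancel.\<close>
      ultimately have "p = []"
        using w(1) pqs(1,3) by (cases p) (auto simp: E0_def)
      then have "length w \<le> length v'" using pqs by simp
      then show "x \<in> subst_hom b ` {w \<in> carrier (FG n). length w \<le> length v'}"
        using w by blast
    qed
    then show ?thesis by (rule finite_subset) (intro finite_imageI finite_bounded_FG)
  qed
  have gen: "x \<cdot> b i \<in> E \<longleftrightarrow> x \<in> E" if x: "x \<in> carrier (FG n)" and i: "i \<in> S" for x i
  proof -
    have i': "i < n" "i \<noteq> j" using i S j by auto
    then have e: "[(i, False)] \<in> carrier (FG n)" by simp
    have bi: "b i = subst_hom b [(i, False)]" using FG_reduced[OF b_FG[OF i'(1)]] by simp
    obtain w where w: "w \<in> carrier (FG n)" "x = subst_hom b w" using ex x by blast
    obtain p q s where pqs: "w = p @ q" "[(i, False)] = word_inv q @ s" "w \<cdot> [(i, False)] = p @ s"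
      using word_mult_cancellation w e by blast
    have "w \<cdot> [(i, False)] \<in> E0 \<longleftrightarrow> w \<in> E0"
    proof (cases p)
      case Nil
      \<comment> \<open>All of \<open>w\<close> cancels, so \<open>w\<close> and the product are
        each \<open>[]\<close> or one letter of index \<open>i\<close>, and neither starts with
        \<open>(j, False)\<close>.\<close>
      then have "q = [] \<or> q = [letter_inv (i, False)]"
        using pqs by (cases q rule: rev_cases) (auto simp: word_inv_def)
      then show ?thesis using Nil pqs i' by (auto simp: E0_def letter_inv_def)
    next
      case Cons
      then show ?thesis
        using w(1) word_mult_in_FG[OF w(1) e] pqs by (auto simp: E0_def)
    qed
    moreover have "x \<cdot> b i = subst_hom b (w \<cdot> [(i, False)])"
      unfolding bi w(2) by (rule subst_hom_mult[OF b_FG w(1) e, symmetric])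
    ultimately show ?thesis
      using E_iff[of w] E_iff[of "w \<cdot> [(i, False)]"] w e by simp
  qed
  from g have "g \<in> carrier (FG n) \<and> (\<forall>x\<in>carrier (FG n). x \<cdot> g \<in> E \<longleftrightarrow> x \<in> E)"
  proof (induction rule: generate.induct)
    case one
    then show ?case by (auto simp: FG_reduced)
  next
    case (incl h)
    then show ?case using gen b_FG S by auto
  next
    case (inv h)
    then obtain i where i: "i \<in> S" "h = b i" by auto
    then have h: "h \<in> carrier (FG n)" using b_FG S by auto
    have "x \<cdot> word_inv h \<in> E \<longleftrightarrow> x \<in> E" if "x \<in> carrier (FG n)" for x
      using gen[of "x \<cdot> word_inv h" i] that h i FG_reduced[OF h] FG_reduced[OF that]
      by (simp add: word_mult_assoc word_mult_inv')
    then show ?case using h by (simp add: inv_FG)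
  next
    case (eng h1 h2)
    have "x \<cdot> h1 \<cdot> h2 \<in> E \<longleftrightarrow> x \<in> E" if "x \<in> carrier (FG n)" for x
      using eng that word_mult_assoc[of h2 x h1] by (metis FG_reduced word_mult_in_FG)
    then show ?case using eng by simp
  qed
  then have inv: "\<forall>x\<in>carrier (FG n). x \<cdot> g \<in> E \<longleftrightarrow> x \<in> E" by blast
  \<comment> \<open>For \<open>e = False\<close> these are the positive powers of
    \<open>b j\<close>, inside \<open>E\<close>; for \<open>e = True\<close> the negative ones,
    outside \<open>E\<close>.\<close>
  have "infinite (subst_hom b ` range (\<lambda>k. replicate (Suc k) (j, e)))" for e
    using bij j infinite_replicate[of "(j, e)"] replicate_in_FG[of "(j, e)" n]
    by (subst finite_image_iff)
      (auto simp: bij_betw_def simp del: replicate_Suc elim!: inj_on_subset)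
  moreover have "subst_hom b ` range (\<lambda>k. replicate (Suc k) (j, False)) \<subseteq> carrier (FG n) \<inter> E"
    and "subst_hom b ` range (\<lambda>k. replicate (Suc k) (j, True)) \<subseteq> carrier (FG n) - E"
    using j E_iff replicate_in_FG[of _ n] subst_hom_in_FG[OF b_FG]
    by (auto simp: E0_def simp del: replicate_Suc subst_hom_simps)
  ultimately have "infinite (carrier (FG n) \<inter> E)" "infinite (carrier (FG n) - E)"
    by (metis finite_subset)+
  then show ?thesis using fin inv unfolding cut_def by blast
qed

text \<open>Right translation by \<open>word_inv u\<close> carries one situation to the other:
  \<open>x \<cdot> v \<cdot> word_inv u\<close> is the translate of \<open>x\<close> times
  \<open>u \<cdot> v \<cdot> word_inv u\<close>. Taking \<open>c\<close> for \<open>v\<close> gives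
  the invariance.\<close>

lemma cut_conj:
  assumes "cut n (u \<cdot> c \<cdot> word_inv u) E" and u: "u \<in> carrier (FG n)" and c: "c \<in> carrier (FG n)"
  shows "cut n c {x. x \<cdot> word_inv u \<in> E}"
proof -
  let ?F = "carrier (FG n)"
  let ?f = "\<lambda>x. x \<cdot> word_inv u"
  have ru: "reduced u" "reduced c" using u c by auto
  have bij: "bij_betw ?f ?F ?F"
    by (rule bij_betw_byWitness[where f' = "\<lambda>x. x \<cdot> u"])
       (use u ru in \<open>auto simp: FG_reduced word_mult_assoc word_mult_inv word_mult_inv'\<close>)
  have inj: "inj_on ?f A" if "A \<subseteq> ?F" for A
    using bij that by (auto simp: bij_betw_def elim: inj_on_subset)
  have surj: "?f ` ?F = ?F" using bij by (auto simp: bij_betw_def)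
  have fin: "finite A" if "finite B" "A \<subseteq> ?F" "?f ` A \<subseteq> B" for A B
    using that inj by (metis finite_image_iff finite_subset)
  have "finite {x \<in> ?F. (?f x \<in> E) \<noteq> (?f (x \<cdot> v) \<in> E)}" if v: "v \<in> ?F" for v
  proof (rule fin)
    have rv: "reduced v" using v by auto
    have "u \<cdot> v \<cdot> word_inv u \<in> ?F" using u v by simp
    then show "finite {x \<in> ?F. (x \<in> E) \<noteq> (x \<cdot> u \<cdot> v \<cdot> word_inv u \<in> E)}"
      using assms(1) by (auto simp: cut_def)
    show "?f ` {x \<in> ?F. (?f x \<in> E) \<noteq> (?f (x \<cdot> v) \<in> E)}
        \<subseteq> {x \<in> ?F. (x \<in> E) \<noteq> (x \<cdot> u \<cdot> v \<cdot> word_inv u \<in> E)}"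
      using u v ru rv by (auto simp: word_mult_assoc word_mult_inv_cancel')
  qed auto
  moreover have "?f (x \<cdot> c) \<in> E \<longleftrightarrow> ?f x \<in> E" if "x \<in> ?F" for x
  proof -
    have "?f x \<in> ?F" using u that by simp
    then have "?f x \<cdot> u \<cdot> c \<cdot> word_inv u \<in> E \<longleftrightarrow> ?f x \<in> E"
      using assms(1) by (auto simp: cut_def)
    then show ?thesis using ru by (simp add: word_mult_assoc word_mult_inv_cancel')
  qed
  moreover have "infinite (?F \<inter> {x. ?f x \<in> E})" "infinite (?F - {x. ?f x \<in> E})"
  proof -
    have "?f ` (?F \<inter> {x. ?f x \<in> E}) = ?F \<inter> E" "?f ` (?F - {x. ?f x \<in> E}) = ?F - E"
      using surj by auto
    moreover have "infinite (?F \<inter> E)" "infinite (?F - E)" using assms(1) by (auto simp: cut_def)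
    ultimately show "infinite (?F \<inter> {x. ?f x \<in> E})" "infinite (?F - {x. ?f x \<in> E})"
      by (metis finite_imageI)+
  qed
  ultimately show ?thesis by (simp add: cut_def)
qed

section \<open>Cyclically reduced words, their powers and rays\<close>

definition cyc_reduced :: "word \<Rightarrow> bool" where
  "cyc_reduced c \<longleftrightarrow> reduced c \<and> c \<noteq> [] \<and> hd c \<noteq> letter_inv (last c)"

definition wpow :: "word \<Rightarrow> nat \<Rightarrow> word" where
  "wpow c k = concat (replicate k c)"

lemma wpow_simps: "wpow c 0 = []" "wpow c (Suc k) = c @ wpow c k"
  by (simp_all add: wpow_def)

lemma wpow_Suc': "wpow c (Suc k) = wpow c k @ c"
  by (induction k) (simp_all add: wpow_simps)

lemma cyc_reduced_word_inv: "cyc_reduced c \<Longrightarrow> cyc_reduced (word_inv c)"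
  unfolding cyc_reduced_def by (metis hd_word_inv last_word_inv letter_inv_inv reduced_word_inv word_inv_simps(6))

lemma reduced_wpow: "cyc_reduced c \<Longrightarrow> reduced (wpow c k)"
proof (induction k)
  case (Suc k)
  then have "hd (wpow c k) = hd c" if "k > 0"
    using that by (cases k) (auto simp: wpow_simps cyc_reduced_def)
  then show ?case using Suc
    by (cases k) (auto simp: wpow_simps reduced_append_iff cyc_reduced_def)
qed (simp add: wpow_simps)

lemma set_wpow: "set (wpow c k) \<subseteq> set c"
  by (auto simp: wpow_def)

lemma wpow_in_FG: "cyc_reduced c \<Longrightarrow> c \<in> carrier (FG n) \<Longrightarrow> wpow c k \<in> carrier (FG n)"
  using set_wpow[of c k] by (auto simp: FG_iff reduced_wpow)

text \<open>In the tree with edges from \<open>x\<close> to \<open>x \<cdot> [a]\<close>, these are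
  the vertices whose geodesic from the root passes through \<open>y\<close>.\<close>

definition cone :: "nat \<Rightarrow> word \<Rightarrow> word set" where
  "cone n y = {x \<in> carrier (FG n). prefix y x}"

text \<open>Reading \<open>q\<close> from \<open>y\<close> and then the period \<open>p @ q\<close>
  forever follows half of a translate of the axis of \<open>p @ q\<close>. By invariance, membership
  in \<open>E\<close> is the same at the ends of all periods.\<close>

lemma infinite_ray_in_cone:
  assumes c: "cyc_reduced (p @ q)" "p @ q \<in> carrier (FG n)" and q: "q \<noteq> []"
    and y: "y \<in> carrier (FG n)" "reduced (y @ q)"
    and E: "\<And>x. x \<in> carrier (FG n) \<Longrightarrow> x \<cdot> (p @ q) \<in> E \<longleftrightarrow> x \<in> E"
  shows "infinite {x \<in> cone n (y @ [hd q]). x \<in> E \<longleftrightarrow> y @ q \<in> E}"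
proof -
  define r where "r = (\<lambda>k. y @ q @ wpow (p @ q) k)"
  have r: "r k \<in> carrier (FG n)" for k
  proof -
    have "reduced (q @ wpow (p @ q) k)"
      using reduced_wpow[OF c(1), of "Suc k"] by (simp add: wpow_simps reduced_append_iff)
    then have "reduced (r k)"
      using y q by (auto simp: r_def reduced_append_iff)
    then show ?thesis
      using y(1) c(2) set_wpow[of "p @ q" k] by (auto simp: r_def FG_iff)
  qed
  have "r k \<in> E \<longleftrightarrow> y @ q \<in> E" for k
  proof (induction k)
    case (Suc k)
    have "r (Suc k) = r k @ (p @ q)" by (simp add: r_def wpow_Suc')
    also have "\<dots> = r k \<cdot> (p @ q)"
      using r[of "Suc k"] by (intro word_mult_eq_append[symmetric]) (auto simp: r_def wpow_Suc')
    finally show ?case using Suc E[OF r] by simp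
  qed (simp add: r_def wpow_simps)
  moreover have "prefix (y @ [hd q]) (r k)" for k
    using q by (cases q) (auto simp: r_def)
  ultimately have "range r \<subseteq> {x \<in> cone n (y @ [hd q]). x \<in> E \<longleftrightarrow> y @ q \<in> E}"
    using r by (auto simp: cone_def)
  moreover have "strict_mono (\<lambda>k. length (r k))"
    using q by (simp add: strict_mono_Suc_iff r_def wpow_simps)
  then have "inj (\<lambda>k. length (r k))"
    by (rule strict_mono_imp_inj_on)
  then have "inj r"
    by (simp add: inj_def)
  then have "infinite (range r)" using finite_imageD[of r UNIV] infinite_UNIV_nat by blast
  ultimately show ?thesis using finite_subset by blast
qed

text \<open>The Whitehead graph of such a word joins any two distinct letters: \<open>[a, b]\<close>
  contributes the edge between \<open>letter_inv a\<close> and \<open>b\<close>.\<close>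

definition full_word :: "nat \<Rightarrow> word \<Rightarrow> bool" where
  "full_word n c \<longleftrightarrow>
     (\<forall>a b. fst a < n \<longrightarrow> fst b < n \<longrightarrow> b \<noteq> letter_inv a \<longrightarrow> sublist [a, b] c)"

text \<open>Far out, a whole cone lies on one side of \<open>E\<close>. If two child cones of a
  vertex lay on opposite sides up to finite sets, a periodic line through the vertex would join them
  and contradict invariance. So one-sidedness passes inward to the root, whose cone is
  everything.\<close>

lemma not_cut_full_word:
  assumes c: "cyc_reduced c" "c \<in> carrier (FG n)" "full_word n c"
  shows "\<not> cut n c E"
proof
  assume cut: "cut n c E"
  let ?F = "carrier (FG n)"
  have E: "x \<cdot> c \<in> E \<longleftrightarrow> x \<in> E" if "x \<in> ?F" for x
    using cut that by (auto simp: cut_def)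
  have rc: "reduced c" using c by auto
  have E': "x \<cdot> word_inv c \<in> E \<longleftrightarrow> x \<in> E" if "x \<in> ?F" for x
    using E[of "x \<cdot> word_inv c"] that c rc by (auto simp: word_mult_assoc word_mult_inv')
  define mono where "mono = (\<lambda>y. finite (cone n y \<inter> E) \<or> finite (cone n y - E))"
  \<comment> \<open>These are the endpoints of the tree edges along which membership in
    \<open>E\<close> changes.\<close>
  define Bad where "Bad = (\<Union>a\<in>{a. fst a < n}. {x \<in> ?F. (x \<in> E) \<noteq> (x \<cdot> [a] \<in> E)})"
  have "finite Bad"
    unfolding Bad_def
    using cut by (intro finite_UN_I finite_letters) (auto simp: cut_def)
  then obtain R where R: "\<And>x. x \<in> Bad \<Longrightarrow> length x < R"
    by (metis finite_imageI finite_nat_set_iff_bounded image_eqI)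
  have far: "mono y" if y: "y \<in> ?F" "length y \<ge> R" for y
  proof -
    have "y @ w \<in> E \<longleftrightarrow> y \<in> E" if "y @ w \<in> ?F" for w
      using that
    proof (induction w rule: rev_induct)
      case (snoc a w)
      then have F: "y @ w \<in> ?F" and a: "fst a < n"
        by (auto simp: FG_iff reduced_append_iff)
      have "y @ w \<notin> Bad" using R[of "y @ w"] y(2) by fastforce
      then have "y @ w \<in> E \<longleftrightarrow> (y @ w) \<cdot> [a] \<in> E"
        using F a unfolding Bad_def by blast
      moreover have "(y @ w) \<cdot> [a] = y @ w @ [a]"
        using snoc.prems word_mult_eq_append[of "y @ w" "[a]"] by auto
      ultimately show ?case using snoc.IH F by simp
    qed simp
    then have "cone n y \<inter> E = {} \<or> cone n y - E = {}"
      by (auto simp: cone_def prefix_def)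
    then show ?thesis unfolding mono_def by (metis finite.emptyI)
  qed
  have step: "mono y" if y: "y \<in> ?F" and IH: "\<And>a. y @ [a] \<in> ?F \<Longrightarrow> mono (y @ [a])" for y
  proof -
    define N where "N = {a. y @ [a] \<in> ?F}"
    have "N \<subseteq> {a. fst a < n}" by (auto simp: N_def FG_iff)
    then have fN: "finite N" using finite_letters by (rule finite_subset)
    have cone: "cone n y \<subseteq> insert y (\<Union>a\<in>N. cone n (y @ [a]))"
    proof
      fix x assume "x \<in> cone n y"
      then obtain w where w: "x = y @ w" "x \<in> ?F" by (auto simp: cone_def prefix_def)
      show "x \<in> insert y (\<Union>a\<in>N. cone n (y @ [a]))"
      proof (cases w)
        case (Cons a v)
        then have "a \<in> N" "x \<in> cone n (y @ [a])"
          using w by (auto simp: N_def FG_iff cone_def reduced_append_iff)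
        then show ?thesis by blast
      qed (use w in simp)
    qed
    have "(\<forall>a\<in>N. finite (cone n (y @ [a]) \<inter> E)) \<or> (\<forall>a\<in>N. finite (cone n (y @ [a]) - E))"
    proof (rule ccontr)
      assume "\<not> ?thesis"
      then obtain a a' where a: "a \<in> N" "a' \<in> N" "infinite (cone n (y @ [a]) \<inter> E)"
        "infinite (cone n (y @ [a']) - E)" by blast
      then have fin: "finite (cone n (y @ [a]) - E)" "finite (cone n (y @ [a']) \<inter> E)"
        using IH[of a] IH[of a'] unfolding N_def mono_def by blast+
      then have "a' \<noteq> a" using a by auto
      moreover have "fst a < n" "fst a' < n" using a by (auto simp: N_def FG_iff)
      \<comment> \<open>Cutting \<open>c\<close> between these two letters gives \<open>q\<close>
        leaving \<open>y\<close> towards \<open>a'\<close> and \<open>word_inv p\<close> leaving it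
        towards \<open>a\<close>.\<close>
      ultimately have "sublist [letter_inv a, a'] c"
        using c(3) unfolding full_word_def by (metis fst_letter_inv letter_inv_inv)
      then obtain p' q' where "c = p' @ [letter_inv a, a'] @ q'" by (auto simp: sublist_def)
      then obtain p q where pq: "c = p @ q" "p \<noteq> []" "q \<noteq> []" "last p = letter_inv a" "hd q = a'"
        by (metis append.assoc append_Cons append_Nil last_snoc list.sel(1) list.simps(3) snoc_eq_iff_butlast)
      have red: "reduced p" "reduced q" using rc pq by (auto simp: reduced_append_iff)
      have y1: "reduced (y @ q)"
        using a(2) pq red by (auto simp: N_def FG_iff reduced_append_iff)
      have y2: "reduced (y @ word_inv p)"
        using a(1) pq red by (auto simp: N_def FG_iff reduced_append_iff hd_word_inv)
      \<comment> \<open>The translate of the axis of \<open>c\<close> through \<open>y\<close> has one end in each of the two cones.\<close>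
      have "infinite {x \<in> cone n (y @ [a']). x \<in> E \<longleftrightarrow> y @ q \<in> E}"
        using infinite_ray_in_cone[of p q n y E] c E y y1 pq by simp
      then have "y @ q \<notin> E"
        using fin(2) by (metis (mono_tags, lifting) IntI finite_subset mem_Collect_eq subsetI)
      moreover have "infinite {x \<in> cone n (y @ [a]). x \<in> E \<longleftrightarrow> y @ word_inv p \<in> E}"
        using infinite_ray_in_cone[of "word_inv q" "word_inv p" n y E] E' y y2 pq
          cyc_reduced_word_inv[OF c(1)] c(2) word_inv_in_FG_iff[of c n]
        by (simp add: hd_word_inv del: word_inv_in_FG_iff)
      then have "y @ word_inv p \<in> E"
        using fin(1) by (metis (mono_tags, lifting) DiffI finite_subset mem_Collect_eq subsetI)
      \<comment> \<open>The two vertices are one period apart on the same line, so \<open>E\<close>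
        contains both or neither.\<close>
      moreover have "(y @ word_inv p) \<cdot> c = y @ q"
      proof -
        have "(y @ word_inv p) \<cdot> c = (y \<cdot> word_inv p) \<cdot> (p \<cdot> q)"
          using y2 rc pq by (simp add: word_mult_eq_append)
        also have "\<dots> = y \<cdot> q"
          using red by (simp add: word_mult_assoc word_mult_inv_cancel')
        finally show ?thesis using y1 by (simp add: word_mult_eq_append)
      qed
      moreover have "y @ word_inv p \<in> ?F"
        using y y2 c(2) pq by (simp add: FG_iff set_word_inv ball_Un)
      ultimately show False using E by metis
    qed
    then show ?thesis
    proof
      assume "\<forall>a\<in>N. finite (cone n (y @ [a]) \<inter> E)"
      then have "finite (insert y (\<Union>a\<in>N. cone n (y @ [a]) \<inter> E))"
        using fN by (intro finite.insertI finite_UN_I) blast+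
      moreover have "cone n y \<inter> E \<subseteq> insert y (\<Union>a\<in>N. cone n (y @ [a]) \<inter> E)" using cone by blast
      ultimately show ?thesis unfolding mono_def by (metis finite_subset)
    next
      assume "\<forall>a\<in>N. finite (cone n (y @ [a]) - E)"
      then have "finite (insert y (\<Union>a\<in>N. cone n (y @ [a]) - E))"
        using fN by (intro finite.insertI finite_UN_I) blast+
      moreover have "cone n y - E \<subseteq> insert y (\<Union>a\<in>N. cone n (y @ [a]) - E)" using cone by blast
      ultimately show ?thesis unfolding mono_def by (metis finite_subset)
    qed
  qed
  \<comment> \<open>Truncated subtraction makes the length condition void at \<open>k = R\<close>,
    so the empty word is covered there.\<close>
  have "\<forall>y\<in>?F. length y \<ge> R - k \<longrightarrow> mono y" for k
  proof (induction k)
    case 0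
    then show ?case using far by simp
  next
    case (Suc k)
    show ?case
    proof (intro ballI impI)
      fix y assume y: "y \<in> ?F" "R - Suc k \<le> length y"
      have "mono (y @ [a])" if "y @ [a] \<in> ?F" for a
        using Suc.IH that y(2) by (simp add: le_diff_conv)
      then show "mono y" using step y(1) by blast
    qed
  qed
  from this[of R] have "mono []" by simp
  moreover have "cone n [] = ?F" by (simp add: cone_def)
  ultimately show False using cut by (simp add: mono_def cut_def)
qed

section \<open>Separable elements and the Whitehead complex\<close>

lemma sublist_word_inv: "sublist (word_inv u) (word_inv w) \<longleftrightarrow> sublist u w"
proof -
  have "sublist (word_inv u) (word_inv w)" if "sublist u w" for u w
  proof -
    from that obtain p s where "w = p @ u @ s" by (auto simp: sublist_def)
    then have "word_inv w = word_inv s @ word_inv u @ word_inv p" by simp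
    then show ?thesis unfolding sublist_def by blast
  qed
  from this[of u w] this[of "word_inv u" "word_inv w"] show ?thesis by auto
qed

lemma full_word_word_inv: "full_word n w \<Longrightarrow> full_word n (word_inv w)"
  unfolding full_word_def
proof (intro allI impI)
  fix a b
  assume w: "\<forall>a b. fst a < n \<longrightarrow> fst b < n \<longrightarrow> b \<noteq> letter_inv a \<longrightarrow> sublist [a, b] w"
    and ab: "fst a < n" "fst b < n" "b \<noteq> letter_inv a"
  have "letter_inv a \<noteq> letter_inv (letter_inv b)" using ab by auto
  then have "sublist [letter_inv b, letter_inv a] w"
    using w ab by (metis fst_letter_inv)
  then show "sublist [a, b] (word_inv w)"
    using sublist_word_inv[of "[letter_inv b, letter_inv a]" w] by simp
qed

lemma full_word_sublist: "full_word n w \<Longrightarrow> sublist w c \<Longrightarrow> full_word n c"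
  unfolding full_word_def by (meson sublist_order.order.trans)

lemma cyclic_reduction:
  assumes "reduced s"
  shows "\<exists>u c. s = u @ c @ word_inv u \<and> (c = [] \<or> cyc_reduced c)"
  using assms
proof (induction s rule: length_induct)
  case (1 s)
  show ?case
  proof (cases "s = [] \<or> cyc_reduced s")
    case True
    then show ?thesis by (intro exI[of _ "[]"] exI[of _ s]) auto
  next
    case False
    then have s: "s \<noteq> []" "hd s = letter_inv (last s)"
      using "1.prems" by (auto simp: cyc_reduced_def)
    then obtain a t where t: "s = a # t" by (cases s) auto
    with s have "t \<noteq> []" by auto
    then obtain r where r: "t = r @ [letter_inv a]"
      using s t by (metis append_butlast_last_id last_ConsR letter_inv_inv list.sel(1))
    have "reduced r" using "1.prems" t r by (auto simp: reduced_Cons_iff reduced_append_iff)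
    then obtain u c where uc: "r = u @ c @ word_inv u" "c = [] \<or> cyc_reduced c"
      using "1.IH" t r by (metis length_append_singleton length_Cons less_Suc_eq less_SucI)
    then show ?thesis using t r
      by (intro exI[of _ "a # u"] exI[of _ c]) simp
  qed
qed

text \<open>Write \<open>s\<close> as a conjugate of \<open>c\<close>, with \<open>c\<close> empty
  or cyclically reduced. In the latter case the cut for \<open>s\<close> moves to \<open>c\<close>,
  so \<open>c\<close> is not full and contains neither \<open>w\<close> nor its inverse. Thus
  \<open>brooks w c = 0\<close>, the values at \<open>u\<close> and \<open>word_inv u\<close> are
  opposite, and two junctions remain.\<close>

lemma brooks_sep_bound:
  assumes s: "s \<in> sep n" and w: "full_word n w" "w \<noteq> []"
  shows "\<bar>brooks w s\<bar> \<le> 2 * length w"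
proof -
  have sF: "s \<in> carrier (FG n)" using s by (simp add: sep_def)
  then obtain u c where uc: "s = u @ c @ word_inv u" "c = [] \<or> cyc_reduced c"
    using cyclic_reduction by blast
  have F: "u \<in> carrier (FG n)" "c \<in> carrier (FG n)"
    using sF uc by (auto simp: FG_iff reduced_append_iff)
  have "brooks w c = 0"
  proof (cases "c = []")
    case False
    then have c: "cyc_reduced c" using uc by blast
    have red: "reduced (u @ c @ word_inv u)" "reduced (c @ word_inv u)"
      using sF uc by (auto simp: reduced_append_iff)
    have "s = u \<cdot> c \<cdot> word_inv u"
      using word_mult_eq_append[OF red(1)] word_mult_eq_append[OF red(2)] uc by simp
    then obtain E where "cut n c E"
      using sep_imp_cut[OF s] cut_conj F by metis
    then have "\<not> full_word n c" using not_cut_full_word c F by blast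
    then have "\<not> sublist w c" "\<not> sublist (word_inv w) c"
      using full_word_sublist full_word_word_inv w by blast+
    then show ?thesis by (simp add: brooks_def occ_eq_0)
  qed (use w in simp)
  then show ?thesis
    using brooks_append[of w u "c @ word_inv u"] brooks_append[of w c "word_inv u"]
      brooks_word_inv[of w u] w uc by simp
qed

section \<open>Paths in the Whitehead complex\<close>

lemma conj_class_self: "g \<in> carrier (FG n) \<Longrightarrow> g \<in> conj_class n g"
  by (auto simp: conj_class_def intro!: bexI[of _ "[]"] FG_reduced)

lemma sym_wh_edges: "sym (wh_edges n)"
  unfolding sym_def wh_edges_def by blast

lemma sym_relpow: "sym R \<Longrightarrow> sym (R ^^ k)"
proof (induction k)
  case (Suc k)
  then have "(R ^^ k)\<inverse> = R ^^ k" "R\<inverse> = R" by (auto simp: sym_conv_converse_eq)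
  then show ?case
    by (simp add: sym_conv_converse_eq converse_relcomp relpow_commute)
qed (simp add: sym_Id)

text \<open>Conjugating the standard basis by \<open>u\<close> gives a basis, and a single member of
  it generates a proper free factor because \<open>n \<ge> 2\<close>.\<close>

lemma letter_conj_sep:
  assumes n: "n \<ge> 2" and u: "u \<in> carrier (FG n)" and a: "fst a < n"
  shows "u \<cdot> [a] \<cdot> word_inv u \<in> sep n"
proof -
  let ?F = "carrier (FG n)"
  define b where "b = (\<lambda>i. u \<cdot> [(i, False)] \<cdot> word_inv u)"
  have b_FG: "b i \<in> ?F" if "i < n" for i using that u by (simp add: b_def)
  have ru: "reduced u" using u by auto
  have val: "(if snd a then word_inv (b (fst a)) else b (fst a)) = u \<cdot> [a] \<cdot> word_inv u" for a
    using ru by (cases a) (auto simp: b_def word_inv_word_mult word_mult_assoc letter_inv_def)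
  have eq: "subst_hom b w = u \<cdot> w \<cdot> word_inv u" if "w \<in> ?F" for w
    using that
  proof (induction w)
    case (Cons a w)
    then have w: "w \<in> ?F" by (auto simp: FG_iff reduced_Cons_iff)
    have "(a # w) \<cdot> word_inv u = [a] \<cdot> w \<cdot> word_inv u"
      using word_mult_append_left[of "[a]" w] by simp
    then show ?case
      using Cons.IH[OF w] ru by (simp add: val word_mult_assoc word_mult_inv_cancel')
  qed (simp add: ru word_mult_inv)
  have "bij_betw (subst_hom b) ?F ?F"
  proof (rule bij_betw_byWitness[where f' = "\<lambda>w. word_inv u \<cdot> w \<cdot> u"])
    show "\<forall>w\<in>?F. word_inv u \<cdot> subst_hom b w \<cdot> u = w"
      using ru by (auto simp: eq FG_reduced word_mult_assoc word_mult_inv_cancel' word_mult_inv')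
    show "\<forall>w\<in>?F. subst_hom b (word_inv u \<cdot> w \<cdot> u) = w"
      using ru u by (auto simp: eq FG_reduced word_mult_assoc word_mult_inv_cancel word_mult_inv)
  qed (use u eq in auto)
  then have "is_basis n b" using b_FG by (simp add: is_basis_def)
  moreover have "{fst a} \<subset> {..<n}"
  proof -
    have "\<exists>i<n. i \<noteq> fst a" using n by (intro exI[of _ "if fst a = 0 then 1 else 0"]) auto
    then show ?thesis using a by auto
  qed
  moreover have "u \<cdot> [a] \<cdot> word_inv u \<in> generate (FG n) (b ` {fst a})"
    using val[of a] generate.incl[of "b (fst a)" "b ` {fst a}" "FG n"]
      generate.inv[of "b (fst a)" "b ` {fst a}" "FG n"] inv_FG[OF b_FG[OF a]]
    by (metis imageI singletonI)
  moreover have "u \<cdot> [a] \<cdot> word_inv u \<in> ?F" using u a by simp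
  ultimately show ?thesis unfolding sep_def by blast
qed

text \<open>Inserting \<open>a\<close> after \<open>u\<close> is left multiplication by
  \<open>u \<cdot> [a] \<cdot> word_inv u\<close>, which is separable. So a letter can be inserted
  anywhere at the cost of one edge.\<close>

lemma wh_edge_insert_letter:
  assumes "n \<ge> 2" "u \<in> carrier (FG n)" "v \<in> carrier (FG n)" "fst a < n"
  shows "(conj_class n (u \<cdot> v), conj_class n (u \<cdot> [a] \<cdot> v)) \<in> wh_edges n"
proof -
  have red: "reduced u" "reduced v" using assms by auto
  have F: "u \<cdot> v \<in> carrier (FG n)" "u \<cdot> [a] \<cdot> v \<in> carrier (FG n)" using assms by auto
  have "u \<cdot> [a] \<cdot> v = (u \<cdot> [a] \<cdot> word_inv u) \<cdot> (u \<cdot> v)"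
    using red by (simp add: word_mult_assoc word_mult_inv_cancel')
  moreover have "u \<cdot> [a] \<cdot> word_inv u \<in> sep n"
    using letter_conj_sep assms by blast
  ultimately show ?thesis
    using F conj_class_self[OF F(1)] conj_class_self[OF F(2)]
    unfolding wh_edges_def wh_vertices_def by blast
qed

lemma wh_path_insert_word:
  assumes n: "n \<ge> 2" and u: "u \<in> carrier (FG n)" and v: "v \<in> carrier (FG n)"
    and p: "p \<in> carrier (FG n)"
  shows "(conj_class n (u \<cdot> v), conj_class n (u \<cdot> p \<cdot> v)) \<in> wh_edges n ^^ length p"
  using p
proof (induction p)
  case (Cons a p)
  then have p: "p \<in> carrier (FG n)" "fst a < n"
    by (auto simp: FG_iff reduced_Cons_iff)
  have "(a # p) \<cdot> v = [a] \<cdot> p \<cdot> v"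
    using word_mult_append_left[of "[a]" p v] by simp
  then show ?case
    using relpow_Suc_I[OF Cons.IH[OF p(1)] wh_edge_insert_letter[OF n u _ p(2), of "p \<cdot> v"]] p v
    by simp
qed simp

text \<open>Raising the exponent by one inserts a copy of \<open>g\<close>, one edge per letter;
  lowering it follows such a path backwards.\<close>

lemma wh_path_int_pow:
  assumes n: "n \<ge> 2" and F: "u \<in> carrier (FG n)" "v \<in> carrier (FG n)" "g \<in> carrier (FG n)"
  shows "(conj_class n (u \<cdot> (g [^]\<^bsub>FG n\<^esub> (k :: int)) \<cdot> v),
          conj_class n (u \<cdot> (g [^]\<^bsub>FG n\<^esub> (l :: int)) \<cdot> v))
         \<in> wh_edges n ^^ (nat \<bar>k - l\<bar> * length g)"
proof -
  interpret group "FG n" by (rule group_FG)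
  have pow: "g [^]\<^bsub>FG n\<^esub> (k :: int) \<in> carrier (FG n)" for k using F by simp
  have up: "(conj_class n (u \<cdot> (g [^]\<^bsub>FG n\<^esub> k) \<cdot> v),
          conj_class n (u \<cdot> (g [^]\<^bsub>FG n\<^esub> (k + int r)) \<cdot> v))
         \<in> wh_edges n ^^ (r * length g)" for k :: int and r
  proof (induction r)
    case (Suc r)
    have rv: "reduced v" using F by auto
    have "g [^]\<^bsub>FG n\<^esub> (1 + (k + int r)) = g \<cdot> (g [^]\<^bsub>FG n\<^esub> (k + int r))"
      using int_pow_mult[OF F(3), of 1 "k + int r"] int_pow_1[OF F(3)] by simp
    then have "(g [^]\<^bsub>FG n\<^esub> (k + int (Suc r))) \<cdot> v = g \<cdot> (g [^]\<^bsub>FG n\<^esub> (k + int r)) \<cdot> v"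
      using rv by (simp add: word_mult_assoc add_ac)
    then have "(conj_class n (u \<cdot> (g [^]\<^bsub>FG n\<^esub> (k + int r)) \<cdot> v),
        conj_class n (u \<cdot> (g [^]\<^bsub>FG n\<^esub> (k + int (Suc r))) \<cdot> v)) \<in> wh_edges n ^^ length g"
      using wh_path_insert_word[OF n F(1) _ F(3), of "(g [^]\<^bsub>FG n\<^esub> (k + int r)) \<cdot> v"] pow F
      by simp
    then show ?case
      using relpow_trans[OF Suc] by (simp add: add.commute)
  qed simp
  show ?thesis
  proof (cases "k \<le> l")
    case True
    then show ?thesis using up[of k "nat (l - k)"] by (simp add: abs_if)
  next
    case False
    then show ?thesis
      using up[of l "nat (k - l)"] sym_relpow[OF sym_wh_edges] by (auto dest: symD)
  qed
qed

section \<open>Counting quasimorphisms along paths\<close>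

lemma brooks_conj_class:
  assumes "w \<noteq> []" "g \<in> carrier (FG n)" "h \<in> conj_class n g"
  shows "\<bar>brooks w h - brooks w g\<bar> \<le> 6 * length w"
proof -
  obtain k where k: "k \<in> carrier (FG n)" "h = (k \<cdot> g) \<cdot> word_inv k"
    using assms by (auto simp: conj_class_def)
  then have red: "reduced k" "reduced g" "reduced (word_inv k)" "reduced (k \<cdot> g)" using assms by auto
  show ?thesis
    using brooks_word_mult[OF assms(1) red(4,3)] brooks_word_mult[OF assms(1) red(1,2)]
      brooks_word_inv[of w k] unfolding k(2) by linarith
qed

text \<open>In units of \<open>length w\<close>, passing between a chosen representative and the one
  on the edge costs 6 at either end, and the edge costs 5: 3 for the product and 2 for the separable
  factor. The extra 6 is for \<open>k = 0\<close>, where the classes agree but the representatives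
  may differ.\<close>

lemma brooks_lipschitz:
  assumes w: "full_word n w" "w \<noteq> []"
    and "g \<in> carrier (FG n)" "h \<in> carrier (FG n)"
    and "(conj_class n g, conj_class n h) \<in> wh_edges n ^^ k"
  shows "\<bar>brooks w g - brooks w h\<bar> \<le> (17 * int k + 6) * length w"
  using assms(4,5)
proof (induction k arbitrary: h)
  case 0
  then have "h \<in> conj_class n g" using conj_class_self by auto
  then show ?case using brooks_conj_class[OF w(2) assms(3)] by fastforce
next
  case (Suc k)
  then obtain C where C: "(conj_class n g, C) \<in> wh_edges n ^^ k" "(C, conj_class n h) \<in> wh_edges n"
    by auto
  from C(2) obtain g' g1 h1 s where g': "g' \<in> carrier (FG n)" "C = conj_class n g'"
    and s: "g1 \<in> C" "h1 \<in> conj_class n h" "s \<in> sep n" "h1 = s \<cdot> g1 \<or> g1 = s \<cdot> h1"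
    unfolding wh_edges_def wh_vertices_def by blast
  have red: "reduced s" "reduced g1" "reduced h1"
    using s g' by (auto simp: sep_def conj_class_def)
  have "\<bar>brooks w g1 - brooks w h1\<bar> \<le> 5 * length w"
    using s(4) brooks_word_mult[OF w(2) red(1,2)] brooks_word_mult[OF w(2) red(1,3)]
      brooks_sep_bound[OF s(3) w] by auto
  moreover have "\<bar>brooks w g1 - brooks w g'\<bar> \<le> 6 * length w"
    using brooks_conj_class w g' s by blast
  moreover have "\<bar>brooks w h1 - brooks w h\<bar> \<le> 6 * length w"
    using brooks_conj_class w s Suc.prems by blast
  moreover have "\<bar>brooks w g - brooks w g'\<bar> \<le> (17 * int k + 6) * length w"
    using Suc.IH g' C by blast
  ultimately show ?case by (simp add: algebra_simps)
qed

section \<open>Independent words and the embedding\<close>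

text \<open>Each side forbids at most one letter for \<open>c\<close>, and three candidates are
  available. For an empty \<open>u\<close> or \<open>v\<close> the avoided letter is an unspecified
  one, which does no harm.\<close>

lemma join_words:
  assumes "n \<ge> 2" "u \<in> carrier (FG n)" "v \<in> carrier (FG n)"
  shows "\<exists>c. u @ [c] @ v \<in> carrier (FG n)"
proof -
  obtain c :: letter where "fst c < n" "c \<noteq> letter_inv (last u)" "c \<noteq> letter_inv (hd v)"
  proof -
    have "\<exists>c\<in>{(0, False), (0, True), (1, False)}. c \<noteq> letter_inv (last u) \<and> c \<noteq> letter_inv (hd v)"
      by (cases "letter_inv (last u)"; cases "letter_inv (hd v)") auto
    then obtain c where "c \<in> {(0, False), (0, True), (1, False)}"
      "c \<noteq> letter_inv (last u)" "c \<noteq> letter_inv (hd v)" by blast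
    then show ?thesis using that[of c] assms(1) by auto
  qed
  then have "u @ [c] @ v \<in> carrier (FG n)"
    using assms by (auto simp: FG_iff reduced_append_iff reduced_Cons_iff)
  then show ?thesis ..
qed

text \<open>The words of \<open>P\<close> are chained with linking letters, and \<open>b\<close> is
  put back at the end after each of them.\<close>

lemma exists_superword:
  assumes n: "n \<ge> 2" and b: "fst b < n" and "finite P" "P \<subseteq> carrier (FG n)"
  shows "\<exists>z\<in>carrier (FG n). z \<noteq> [] \<and> hd z = b \<and> last z = b \<and> (\<forall>p\<in>P. sublist p z)"
  using assms(3,4)
proof (induction P rule: finite_induct)
  case empty
  then show ?case using b by (intro bexI[of _ "[b]"]) auto
next
  case (insert p P)
  then obtain z where z: "z \<in> carrier (FG n)" "z \<noteq> []" "hd z = b" "last z = b" "\<forall>p\<in>P. sublist p z"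
    by auto
  obtain c where c: "z @ [c] @ p \<in> carrier (FG n)"
    using join_words[OF n z(1), of p] insert.prems by blast
  obtain d where d: "(z @ [c] @ p) @ [d] @ [b] \<in> carrier (FG n)"
    using join_words[OF n c, of "[b]"] b letter_in_FG by blast
  have "sublist z ((z @ [c] @ p) @ [d] @ [b])" "sublist p ((z @ [c] @ p) @ [d] @ [b])"
    by (auto simp: sublist_def) (metis append.assoc append_Cons append_Nil)+
  then show ?case
    using d z by (intro bexI[OF _ d]) (auto intro: sublist_order.order.trans)
qed

lemma exists_full_word:
  assumes "n \<ge> 2" "fst b < n"
  shows "\<exists>z\<in>carrier (FG n). z \<noteq> [] \<and> hd z = b \<and> last z = b \<and> full_word n z"
proof -
  define P where "P = {w \<in> carrier (FG n). length w \<le> 2}"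
  obtain z where z: "z \<in> carrier (FG n)" "z \<noteq> []" "hd z = b" "last z = b" "\<forall>p\<in>P. sublist p z"
    using exists_superword[OF assms finite_bounded_FG[of n 2]] by (auto simp: P_def)
  have "full_word n z"
    unfolding full_word_def
  proof (intro allI impI)
    fix a c assume "fst a < n" "fst c < n" "c \<noteq> letter_inv a"
    then have "[a, c] \<in> P" by (auto simp: P_def FG_iff)
    then show "sublist [a, c] z" using z by blast
  qed
  then show ?thesis using z by blast
qed

text \<open>Meant for a \<open>z\<close> that is shorter than the run and starts and ends with
  \<open>(1, False)\<close>: the run is then delimited on both sides and its length is visible in
  every power.\<close>

definition run_word :: "word \<Rightarrow> nat \<Rightarrow> word" where
  "run_word z M = (1, False) # replicate M (0, False) @ z"

lemma length_run_word: "length (run_word z M) = 1 + M + length z"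
  by (simp add: run_word_def)

lemma nth_wpow:
  assumes "t < k * length c"
  shows "wpow c k ! t = c ! (t mod length c)"
  using assms
proof (induction k arbitrary: t)
  case (Suc k)
  then show ?case
    by (cases "t < length c") (auto simp: wpow_simps nth_append le_mod_geq)
qed simp

lemma length_wpow: "length (wpow c k) = k * length c"
  by (induction k) (simp_all add: wpow_simps)

lemma sublist_wpowD:
  assumes "sublist u (wpow c k)"
  shows "\<exists>t. \<forall>i<length u. u ! i = c ! ((t + i) mod length c)"
proof -
  from assms obtain p s where eq: "wpow c k = p @ u @ s" by (auto simp: sublist_def)
  have "u ! i = c ! ((length p + i) mod length c)" if "i < length u" for i
  proof -
    have "length p + i < k * length c"
      using that arg_cong[OF eq, of length] by (simp add: length_wpow)
    moreover have "wpow c k ! (length p + i) = u ! i"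
      using that by (simp add: eq nth_append)
    ultimately show ?thesis by (simp add: nth_wpow)
  qed
  then show ?thesis by blast
qed

lemma next_period:
  fixes t P :: nat
  assumes "t mod P \<noteq> 0" "P > 0"
  shows "(t + (P - t mod P)) mod P = 0"
proof -
  have "t + (P - t mod P) = P * (t div P) + P"
    using assms mod_less_divisor[of P t] mult_div_mod_eq[of P t] by linarith
  then show ?thesis by simp
qed

lemma mod_add_small:
  fixes t P i :: nat
  assumes "t mod P + i < P"
  shows "(t + i) mod P = t mod P + i"
  using assms by (metis mod_add_left_eq mod_less)

lemma nth_run_word:
  "run_word z M ! 0 = (1, False)"
  "1 \<le> i \<Longrightarrow> i \<le> M \<Longrightarrow> run_word z M ! i = (0, False)"
  "z \<noteq> [] \<Longrightarrow> run_word z M ! (M + 1) = hd z"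
  by (auto simp: run_word_def nth_append nth_Cons' hd_conv_nth)

context
  fixes z :: word and L M :: nat
  assumes z: "z \<noteq> []" "hd z = (1, False)" and L: "L > length z + 1" and M: "M \<ge> 1"
begin

text \<open>Consider where in a period the word would start. At its first letter, the
  \<open>(1, False)\<close> ending the shorter run falls inside the longer run. Inside the run, the
  first letter is wrong. Inside \<open>z\<close>, the run of length \<open>L\<close> would reach the
  leading \<open>(1, False)\<close> of the next period.\<close>

lemma not_sublist_run_word:
  assumes "L \<noteq> M"
  shows "\<not> sublist (run_word z L) (wpow (run_word z M) k)"
proof
  let ?c = "run_word z M" let ?P = "length (run_word z M)"
  assume "sublist (run_word z L) (wpow ?c k)"
  then obtain t where t: "\<And>i. i < length (run_word z L) \<Longrightarrow> run_word z L ! i = ?c ! ((t + i) mod ?P)"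
    using sublist_wpowD by blast
  have P: "?P = 1 + M + length z" "length z \<ge> 1"
    using z by (simp_all add: length_run_word Suc_le_eq)
  have start: "?c ! (t mod ?P) = (1, False)"
    using t[of 0] nth_run_word(1) by (simp add: length_run_word)
  have run: "?c ! ((t + i) mod ?P) = (0, False)" if "1 \<le> i" "i \<le> L" for i
    using t[of i] nth_run_word(2)[OF that] that by (simp add: length_run_word)
  have stop: "?c ! ((t + (L + 1)) mod ?P) = (1, False)"
    using t[of "L + 1"] nth_run_word(3)[OF z(1), of L] z P by (simp add: length_run_word)
  consider "t mod ?P = 0" | "1 \<le> t mod ?P" "t mod ?P \<le> M" | "t mod ?P > M" by linarith
  then show False
  proof cases
    case 1
    show False
    proof (cases "L < M")
      case True
      then have "(t + (L + 1)) mod ?P = L + 1" using 1 P mod_add_small[of t ?P "L + 1"] by simp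
      then show False using stop nth_run_word(2)[of "L + 1" M z] True by simp
    next
      case False
      then have "M + 1 \<le> L" using assms by simp
      moreover have "(t + (M + 1)) mod ?P = M + 1" using 1 P z(1) mod_add_small[of t ?P "M + 1"] by simp
      ultimately show False using run[of "M + 1"] nth_run_word(3)[OF z(1), of M] z by simp
    qed
  next
    case 2
    then show False using start nth_run_word(2) by simp
  next
    case 3
    have "(t + (?P - t mod ?P)) mod ?P = 0" using 3 P by (intro next_period) auto
    moreover have "1 \<le> ?P - t mod ?P" "?P - t mod ?P \<le> L"
      using 3 P L mod_less_divisor[of ?P t] by linarith+
    ultimately show False using run[of "?P - t mod ?P"] nth_run_word(1) by simp
  qed
qed

text \<open>The inverse contains \<open>L\<close> consecutive letters \<open>(0, True)\<close>.
  These do not fit into a copy of \<open>z\<close>, so they would meet \<open>(1, False)\<close> or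
  \<open>(0, False)\<close>. The case \<open>L = M\<close> is included; it makes the quasimorphism
  of a word grow along its own powers.\<close>

lemma not_sublist_inv_run_word: "\<not> sublist (word_inv (run_word z L)) (wpow (run_word z M) k)"
proof
  let ?c = "run_word z M" let ?P = "length (run_word z M)"
  assume "sublist (word_inv (run_word z L)) (wpow ?c k)"
  moreover have "sublist (replicate L (0, True)) (word_inv (run_word z L))"
  proof -
    have "word_inv (replicate L (0, False)) = replicate L (0, True)"
      by (simp add: word_inv_def letter_inv_def)
    then show ?thesis by (auto simp: run_word_def sublist_def)
  qed
  ultimately have "sublist (replicate L (0, True)) (wpow ?c k)"
    by (rule sublist_order.order.trans[rotated])
  then obtain t where t: "\<And>i. i < L \<Longrightarrow> ?c ! ((t + i) mod ?P) = (0, True)"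
    using sublist_wpowD by (metis length_replicate nth_replicate)
  have P: "?P = 1 + M + length z" "length z \<ge> 1"
    using z by (simp_all add: length_run_word Suc_le_eq)
  consider "t mod ?P = 0" | "1 \<le> t mod ?P" "t mod ?P \<le> M" | "t mod ?P > M" by linarith
  then show False
  proof cases
    case 1
    then show False using t[of 0] L nth_run_word(1) by simp
  next
    case 2
    then show False using t[of 0] L nth_run_word(2) by simp
  next
    case 3
    have "(t + (?P - t mod ?P)) mod ?P = 0" using 3 P by (intro next_period) auto
    moreover have "?P - t mod ?P < L"
      using 3 P L by linarith
    ultimately show False using t[of "?P - t mod ?P"] nth_run_word(1) by simp
  qed
qed

end

lemma occ_wpow_ge:
  assumes "w \<noteq> []"
  shows "k \<le> occ w (wpow w k)"
proof (induction k)
  case (Suc k)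
  then show ?case
    using occ_append_ge[OF assms, of w "wpow w k"] occ_self[of w] by (simp add: wpow_simps)
qed simp

lemma cyc_reduced_run_word:
  assumes "z \<in> carrier (FG n)" "z \<noteq> []" "hd z = (1, False)" "last z = (1, False)"
  shows "cyc_reduced (run_word z M)"
proof -
  have "reduced (replicate M (0, False))" using replicate_in_FG[of "(0, False)" 1 M] by auto
  then show ?thesis
    using assms
    by (auto simp: cyc_reduced_def run_word_def reduced_Cons_iff reduced_append_iff letter_inv_def
        hd_append FG_reduced)
qed

lemma int_pow_eq_wpow:
  assumes "cyc_reduced c" "c \<in> carrier (FG n)"
  shows "c [^]\<^bsub>FG n\<^esub> int k = wpow c k" "c [^]\<^bsub>FG n\<^esub> (- int k) = word_inv (wpow c k)"
proof -
  interpret group "FG n" by (rule group_FG)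
  have nat: "c [^]\<^bsub>FG n\<^esub> k = wpow c k" for k :: nat
  proof (induction k)
    case (Suc k)
    then show ?case
      using reduced_wpow[OF assms(1), of "Suc k"] by (simp add: wpow_Suc' word_mult_eq_append)
  qed (simp add: wpow_simps)
  then show "c [^]\<^bsub>FG n\<^esub> int k = wpow c k" by (simp add: int_pow_int)
  then show "c [^]\<^bsub>FG n\<^esub> (- int k) = word_inv (wpow c k)"
    using assms wpow_in_FG[OF assms] by (simp add: int_pow_neg inv_FG)
qed

section \<open>Products of powers and the embedding\<close>

primrec prodpow :: "nat \<Rightarrow> (nat \<Rightarrow> word) \<Rightarrow> int list \<Rightarrow> nat \<Rightarrow> word" where
  "prodpow n g x 0 = []"
| "prodpow n g x (Suc k) = prodpow n g x k \<cdot> (g k [^]\<^bsub>FG n\<^esub> (x ! k))"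

lemma prodpow_in_FG: "(\<And>i. g i \<in> carrier (FG n)) \<Longrightarrow> prodpow n g x k \<in> carrier (FG n)"
  by (induction k) (simp_all add: group.int_pow_closed[OF group_FG])

text \<open>Exponents are changed one coordinate at a time. The tail \<open>v\<close> serves the
  induction: it absorbs the last factor while the earlier ones change.\<close>

lemma wh_path_prodpow:
  assumes n: "n \<ge> 2" and g: "\<And>i. g i \<in> carrier (FG n)" and v: "v \<in> carrier (FG n)"
  shows "(conj_class n (prodpow n g x k \<cdot> v), conj_class n (prodpow n g y k \<cdot> v))
         \<in> wh_edges n ^^ (\<Sum>i<k. nat \<bar>x ! i - y ! i\<bar> * length (g i))"
  using v
proof (induction k arbitrary: v)
  case (Suc k)
  have F: "g k [^]\<^bsub>FG n\<^esub> i \<in> carrier (FG n)" for i :: int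
    using g by (simp add: group.int_pow_closed[OF group_FG])
  let ?v = "(g k [^]\<^bsub>FG n\<^esub> (x ! k)) \<cdot> v"
  have "(conj_class n (prodpow n g x k \<cdot> ?v), conj_class n (prodpow n g y k \<cdot> ?v))
      \<in> wh_edges n ^^ (\<Sum>i<k. nat \<bar>x ! i - y ! i\<bar> * length (g i))"
    using F Suc.prems by (intro Suc.IH) simp
  moreover have "(conj_class n (prodpow n g y k \<cdot> ?v),
      conj_class n (prodpow n g y k \<cdot> (g k [^]\<^bsub>FG n\<^esub> (y ! k)) \<cdot> v))
      \<in> wh_edges n ^^ (nat \<bar>x ! k - y ! k\<bar> * length (g k))"
    by (rule wh_path_int_pow[OF n prodpow_in_FG[OF g] Suc.prems g])
  moreover have "reduced v" using Suc.prems by auto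
  ultimately show ?case
    using relpow_trans by (fastforce simp: word_mult_assoc)
qed simp

lemma brooks_prodpow:
  assumes w: "w \<noteq> []" and g: "\<And>i. g i \<in> carrier (FG n)"
  shows "\<bar>brooks w (prodpow n g x k) - (\<Sum>i<k. brooks w (g i [^]\<^bsub>FG n\<^esub> (x ! i)))\<bar>
         \<le> int k * (3 * int (length w))"
proof (induction k)
  case (Suc k)
  have "reduced (g k [^]\<^bsub>FG n\<^esub> (x ! k))" "reduced (prodpow n g x k)"
    using FG_reduced[OF group.int_pow_closed[OF group_FG g]] FG_reduced[OF prodpow_in_FG[OF g]] .
  then show ?case
    using Suc brooks_word_mult[OF w, of "prodpow n g x k" "g k [^]\<^bsub>FG n\<^esub> (x ! k)"]
    by (simp add: algebra_simps)
qed (simp add: w)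

theorem mainTheorem9:
  fixes n m :: nat
  assumes "n \<ge> 2"
  shows "\<exists>(f :: int list \<Rightarrow> word set) (K :: real) (C :: real).
           K \<ge> 1 \<and> C \<ge> 0 \<and>
           (\<forall>x. length x = m \<longrightarrow> f x \<in> wh_vertices n) \<and>
           (\<forall>x y. length x = m \<and> length y = m \<longrightarrow>
              l1_dist x y / K - C \<le> real (wh_dist n (f x) (f y)) \<and>
              real (wh_dist n (f x) (f y)) \<le> K * l1_dist x y + C)"
proof -
  obtain z where z: "z \<in> carrier (FG n)" "z \<noteq> []" "hd z = (1, False)" "last z = (1, False)"
    "full_word n z"
    using exists_full_word[OF assms, of "(1, False)"] assms by auto
  \<comment> \<open>The summand \<open>length z + 2\<close> makes every run longer than
    \<open>length z + 1\<close>, and the lengths differ for \<open>i < m\<close>. Capping at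
    \<open>m\<close> lets one bound \<open>N\<close> serve all indices.\<close>
  define g where "g i = run_word z (length z + 2 + min i m)" for i
  define N where "N = 2 * length z + 3 + m"
  have len: "length (g i) \<le> N" for i by (simp add: g_def N_def length_run_word)
  have ne: "g i \<noteq> []" for i by (simp add: g_def run_word_def)
  have cyc: "cyc_reduced (g i)" for i
    unfolding g_def using cyc_reduced_run_word z by blast
  have gF: "g i \<in> carrier (FG n)" for i
    using z(1) cyc[of i] assms by (auto simp: FG_iff g_def run_word_def cyc_reduced_def)
  have full: "full_word n (g i)" for i
    by (rule full_word_sublist[OF z(5)])
      (metis append_Cons append_Nil2 append_assoc g_def run_word_def sublist_def)
  have pow_F: "g i [^]\<^bsub>FG n\<^esub> k \<in> carrier (FG n)" for i and k :: int
    using gF by (simp add: group.int_pow_closed[OF group_FG])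
  have zero: "brooks (g j) (g i [^]\<^bsub>FG n\<^esub> k) = 0" if "i < m" "j < m" "i \<noteq> j" for i j and k :: int
  proof -
    have "occ (g j) (wpow (g i) l) = 0" for l
      unfolding g_def using that z by (intro occ_eq_0 not_sublist_run_word) simp_all
    moreover have "occ (word_inv (g j)) (wpow (g i) l) = 0" for l
      unfolding g_def using that z by (intro occ_eq_0 not_sublist_inv_run_word) simp_all
    ultimately have "brooks (g j) (wpow (g i) l) = 0" for l by (simp add: brooks_def)
    then show ?thesis
      by (cases k rule: int_cases2) (simp_all add: int_pow_eq_wpow[OF cyc gF] brooks_word_inv)
  qed
  have grow: "\<bar>k\<bar> \<le> \<bar>brooks (g i) (g i [^]\<^bsub>FG n\<^esub> k)\<bar>" for i and k :: int
  proof -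
    have "occ (word_inv (g i)) (wpow (g i) l) = 0" for l
      unfolding g_def using z by (intro occ_eq_0 not_sublist_inv_run_word) auto
    then have "int l \<le> brooks (g i) (wpow (g i) l)" for l
      using occ_wpow_ge[OF ne, of l i] by (simp add: brooks_def)
    then show ?thesis
      by (cases k rule: int_cases2)
        (auto simp: int_pow_eq_wpow[OF cyc gF] brooks_word_inv intro: order.trans[OF _ abs_ge_self])
  qed
  \<comment> \<open>The growth estimate is applied to the exponent \<open>k - l\<close>; splitting
    off the power with exponent \<open>l\<close> costs the defect of one product.\<close>
  have diff: "\<bar>k - l\<bar> \<le> \<bar>brooks (g i) (g i [^]\<^bsub>FG n\<^esub> k) - brooks (g i) (g i [^]\<^bsub>FG n\<^esub> l)\<bar> + 3 * int N"
    for i and k l :: int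
  proof -
    have "g i [^]\<^bsub>FG n\<^esub> k = (g i [^]\<^bsub>FG n\<^esub> (k - l)) \<cdot> (g i [^]\<^bsub>FG n\<^esub> l)"
      using group.int_pow_mult[OF group_FG gF, of i "k - l" l] by simp
    then show ?thesis
      using brooks_word_mult[OF ne FG_reduced[OF pow_F] FG_reduced[OF pow_F], of i i "k - l" i l]
        grow[of "k - l" i] len[of i] by simp
  qed

  define h where "h x = prodpow n g x m" for x
  have hF: "h x \<in> carrier (FG n)" for x using prodpow_in_FG gF by (simp add: h_def)
  \<comment> \<open>The factors other than the one with index \<open>j\<close> have value 0, so only
    the defects of the \<open>m\<close> products remain.\<close>
  have coord: "\<bar>brooks (g j) (h x) - brooks (g j) (g j [^]\<^bsub>FG n\<^esub> (x ! j))\<bar> \<le> 3 * int m * int N"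
    if "j < m" for j x
  proof -
    have "(\<Sum>i<m. brooks (g j) (g i [^]\<^bsub>FG n\<^esub> (x ! i)))
        = (\<Sum>i<m. if i = j then brooks (g j) (g j [^]\<^bsub>FG n\<^esub> (x ! j)) else 0)"
      using zero that by (intro sum.cong) auto
    also have "\<dots> = brooks (g j) (g j [^]\<^bsub>FG n\<^esub> (x ! j))" using that by simp
    finally have "\<bar>brooks (g j) (h x) - brooks (g j) (g j [^]\<^bsub>FG n\<^esub> (x ! j))\<bar>
        \<le> int m * (3 * int (length (g j)))"
      using brooks_prodpow[where x = x and k = m and w = "g j" and g = g, OF ne gF] by (simp add: h_def)
    also have "\<dots> \<le> int m * (3 * int N)" using len by (intro mult_left_mono) auto
    finally show ?thesis by simp
  qed
  define B where "B = 17 * int N"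
  \<comment> \<open>The summands come from the additive constant of the Lipschitz bound, from
    \<open>coord\<close> at \<open>x\<close> and at \<open>y\<close>, and from
    \<open>diff\<close>.\<close>
  define D where "D = 6 * int N + 2 * (3 * int m * int N) + 3 * int N"
  have lower: "\<bar>x ! j - y ! j\<bar> \<le> B * int k + D"
    if "(conj_class n (h x), conj_class n (h y)) \<in> wh_edges n ^^ k" "j < m" for x y j k
  proof -
    have "\<bar>brooks (g j) (h x) - brooks (g j) (h y)\<bar> \<le> (17 * int k + 6) * length (g j)"
      by (rule brooks_lipschitz[OF full ne hF hF that(1)])
    also have "\<dots> \<le> (17 * int k + 6) * int N" using len by (intro mult_left_mono) auto
    finally show ?thesis
      using coord[OF that(2), of x] coord[OF that(2), of y] diff[of "x ! j" "y ! j" j]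
      by (simp add: B_def D_def algebra_simps)
  qed
  define f where "f x = conj_class n (h x)" for x
  \<comment> \<open>\<open>N\<close> bounds the edges needed to change one exponent by 1, for the
    upper estimate; \<open>m\<close> times \<open>B\<close> arises when the lower estimate is summed
    over the coordinates.\<close>
  define K where "K = 1 + real N + real m * real_of_int B"
  define C where "C = real m * real_of_int D"
  have nonneg: "B \<ge> 0" "D \<ge> 0" by (simp_all add: B_def D_def)
  then have K: "K \<ge> 1" "C \<ge> 0" by (simp_all add: K_def C_def)
  have main: "l1_dist x y / K - C \<le> real (wh_dist n (f x) (f y)) \<and>
      real (wh_dist n (f x) (f y)) \<le> K * l1_dist x y + C"
    if xy: "length x = m" "length y = m" for x y
  proof -
    define l where "l = (\<Sum>i<m. \<bar>x ! i - y ! i\<bar>)"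
    have l1: "l1_dist x y = real_of_int l" "l \<ge> 0"
      using xy by (simp_all add: l1_dist_def l_def sum_nonneg)
    define S where "S = (\<Sum>i<m. nat \<bar>x ! i - y ! i\<bar> * length (g i))"
    define d where "d = wh_dist n (f x) (f y)"
    have path: "(f x, f y) \<in> wh_edges n ^^ S"
      using wh_path_prodpow[where x = x and y = y and k = m and g = g, OF assms gF Nil_in_FG] FG_reduced[OF hF]
      by (simp add: f_def S_def h_def)
    \<comment> \<open>The explicit path shows that the \<open>LEAST\<close> in
      \<open>wh_dist\<close> is attained.\<close>
    then have d: "(f x, f y) \<in> wh_edges n ^^ d" "d \<le> S"
      unfolding d_def wh_dist_def by (rule LeastI, rule Least_le)
    have "int S \<le> (\<Sum>i<m. \<bar>x ! i - y ! i\<bar> * int N)"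
      unfolding S_def of_nat_sum using len by (intro sum_mono) (simp add: mult_left_mono)
    also have "\<dots> = int N * l" by (simp add: l_def sum_distrib_left mult.commute)
    finally have "real d \<le> real N * real_of_int l"
      using d(2) by (metis of_int_le_iff of_int_mult of_int_of_nat_eq of_nat_le_iff order.trans)
    also have "\<dots> \<le> K * l1_dist x y"
      using l1 nonneg by (simp add: K_def mult_right_mono)
    finally have up: "real d \<le> K * l1_dist x y + C" using K by simp
    have "l \<le> (\<Sum>i<m. B * int d + D)"
      unfolding l_def using lower d(1) by (intro sum_mono) (simp add: f_def)
    then have "real_of_int l \<le> real_of_int (int m * (B * int d + D))"
      by (simp only: of_int_le_iff) simp
    then have "real_of_int l \<le> (real m * real_of_int B) * real d + C"
      by (simp add: C_def algebra_simps)
    \<comment> \<open>The additive constant is enlarged so that dividing by \<open>K\<close> leaves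
      exactly \<open>C\<close>.\<close>
    also have "\<dots> \<le> K * real d + K * C"
      using K nonneg by (intro add_mono mult_right_mono) (auto simp: K_def mult_le_cancel_right1)
    finally have "l1_dist x y / K - C \<le> real d"
      using K l1 by (simp add: field_simps)
    then show ?thesis using up by (simp add: d_def)
  qed
  have "f x \<in> wh_vertices n" for x
    using hF by (simp add: f_def wh_vertices_def)
  then show ?thesis using K main by blast
qed

end
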